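(* Let $G$ be a finite graph on $n$ vertices belonging to an $f$-separable hereditary class, run the STT algorithm on $G$ (against an invisible robber), and let $R_i$ be the territory of the robber after the $i$-th iteration of the outer while loop of the Scheduler. Then for all $k\in\mathbb{N}$ with $|R_k|>0$ we have $R_{k+1}\subsetneq R_k$. Furthermore, the STT algorithm terminates in a finite number of steps with the robber being caught.
   Context: Zero-visibility Cops and Robbers: cops choose starting vertices, then the robber; in each round cops move (stay or go to a neighbour), then the robber does; the robber sees the cops but is invisible to them; capture occurs when a cop occupies the robber's vertex. For analysis, cops are first allowed to be placed on or removed from any vertex (node-search/teleporting model), while the robber moves along edges; when cops must move along edges, each placement is realised by moving cops along paths to the target vertices. The robber's territory at a given time is the set of vertices where a not-yet-caught robber can possibly be located, given the cops' strategy. A set $S\subset V$ is an $(s,\alpha)$-separator of $G=(V,E)$ if $V=A\cup B\cup S$ with $A,B,S$ pairwise disjoint, $|S|\le s$, $|A|,|B|\le\alpha|V|$ and no edge joins $A$ and $B$. The separation number $\mathrm{s}(G)$ is the least $s$ such that every subgraph of $G$ has an $(s,2/3)$-separator. For $f:\mathbb{N}\to\mathbb{N}$, a class $\mathcal{C}$ is $f$-separable if every $n$-vertex $G\in\mathcal{C}$ has $\mathrm{s}(G)\le f(n)$; it is hereditary if closed under induced subgraphs. A separation algorithm $\mathcal{S}$ returns, for a graph $H$ in the class with $m$ vertices, a partition $(A,B,C)$ of $V(H)$ where $C$ is an $(f(m),2/3)$-separator with separated sets $A,B$. STT algorithm on an $n$-vertex graph $G$: it keeps two stacks, Stack-B of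 pairs (vertex set, binary string index) and Stack-C of pairs (separator, index). Scheduler: push $(V(G),\varepsilon)$ ($\varepsilon$ the empty string) on Stack-B, Stack-C empty. While Stack-B is nonempty (outer while loop): pop $(U,w)$ from Stack-B; let $p$ be $w$ with its last character deleted; if Stack-C is nonempty then, while $p$ differs from the index of the top element of Stack-C, pop $(S,w')$ from Stack-C and remove the cops from all vertices of $S$; then call Separate$(G[U],w,n)$. Separate$(H,w,n)$: if $|V(H)|\le f(n)$, call Clear$(H)$, i.e. place cops on all vertices of $H$ and then remove them; otherwise compute $(A,B,C)=\mathcal{S}(H)$, place cops on all vertices of $C$, push $(C,w)$ onto Stack-C, then push $(B,w\cdot0)$ and then $(A,w\cdot1)$ onto Stack-B.
   Formalization: The strict inclusion fails if an iteration places no cop (empty separator or empty popped set); it is proved when the parts A, B, C are always nonempty, and in general as: strict, or R_{k+1}=R_k and iteration k+1 places no cop. Termination and capture are unconditional. *)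

theory Defs
  imports Complex_Main "Graph_Theory.Digraph_Component"
begin

text \<open>
  A finite simple graph is a \<^term>\<open>pre_digraph\<close> satisfying the locale predicate \<^term>\<open>graph\<close>:
  each undirected edge is a pair of opposite arcs.
\<close>

subsection \<open>Separators\<close>

definition separates ::
  "('a, 'b) pre_digraph \<Rightarrow> nat \<Rightarrow> real \<Rightarrow> 'a set \<Rightarrow> 'a set \<Rightarrow> 'a set \<Rightarrow> bool" where
  "separates G s \<alpha> A B S \<longleftrightarrow>
     verts G = A \<union> B \<union> S \<and> A \<inter> B = {} \<and> A \<inter> S = {} \<and> B \<inter> S = {} \<and>
     card S \<le> s \<and>
     real (card A) \<le> \<alpha> * real (card (verts G)) \<and> real (card B) \<le> \<alpha> * real (card (verts G)) \<and>
     (\<forall>a\<in>A. \<forall>b\<in>B. \<not> a \<rightarrow>\<^bsub>G\<^esub> b \<and> \<not> b \<rightarrow>\<^bsub>G\<^esub> a)"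

definition is_separator :: "('a, 'b) pre_digraph \<Rightarrow> nat \<Rightarrow> real \<Rightarrow> 'a set \<Rightarrow> bool" where
  "is_separator G s \<alpha> S \<longleftrightarrow> (\<exists>A B. separates G s \<alpha> A B S)"

definition separation_number :: "('a, 'b) pre_digraph \<Rightarrow> nat" where
  "separation_number G =
     (LEAST s. \<forall>H. subgraph H G \<and> graph H \<longrightarrow> (\<exists>S. is_separator H s (2/3) S))"

definition f_separable :: "(nat \<Rightarrow> nat) \<Rightarrow> ('a, 'b) pre_digraph set \<Rightarrow> bool" where
  "f_separable f \<C> \<longleftrightarrow> (\<forall>G\<in>\<C>. separation_number G \<le> f (card (verts G)))"

definition hereditary :: "('a, 'b) pre_digraph set \<Rightarrow> bool" where
  "hereditary \<C> \<longleftrightarrow> (\<forall>G\<in>\<C>. \<forall>U\<subseteq>verts G. G \<restriction> U \<in> \<C>)"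

definition separation_algorithm ::
  "(nat \<Rightarrow> nat) \<Rightarrow> ('a, 'b) pre_digraph set
    \<Rightarrow> (('a, 'b) pre_digraph \<Rightarrow> 'a set \<times> 'a set \<times> 'a set) \<Rightarrow> bool" where
  "separation_algorithm f \<C> \<S> \<longleftrightarrow>
     (\<forall>H\<in>\<C>. case \<S> H of (A, B, C) \<Rightarrow> separates H (f (card (verts H))) (2/3) A B C)"

subsection \<open>The game\<close>

text \<open>
  A play of the cops is the nonempty chronological list of the vertex sets they occupy: first the
  initial positions, then the positions after each of their moves. In the teleporting model
  consecutive sets are unrelated. The list \<open>rs\<close> below records the robber's initial vertex and his
  vertex after each of his moves; in every round the cops move first, so he must avoid the new cop
  positions both before and after his own move.
\<close>

definition evades :: "('a, 'b) pre_digraph \<Rightarrow> 'a set list \<Rightarrow> 'a list \<Rightarrow> bool" where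
  "evades G Ps rs \<longleftrightarrow>
     length rs = length Ps \<and> set rs \<subseteq> verts G \<and>
     (\<forall>i < length Ps. rs ! i \<notin> Ps ! i) \<and>
     (\<forall>i. Suc i < length Ps \<longrightarrow>
        rs ! i \<notin> Ps ! Suc i \<and> (rs ! Suc i = rs ! i \<or> rs ! i \<rightarrow>\<^bsub>G\<^esub> rs ! Suc i))"

definition territory :: "('a, 'b) pre_digraph \<Rightarrow> 'a set list \<Rightarrow> 'a set" where
  "territory G Ps = {last rs |rs. evades G Ps rs}"

definition robber_caught :: "('a, 'b) pre_digraph \<Rightarrow> 'a set list \<Rightarrow> bool" where
  "robber_caught G Ps \<longleftrightarrow> \<not> (\<exists>rs. evades G Ps rs)"

definition place_cops :: "'a set \<Rightarrow> 'a set list \<Rightarrow> 'a set list" where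
  "place_cops X Ps = Ps @ [last Ps \<union> X]"

definition remove_cops :: "'a set \<Rightarrow> 'a set list \<Rightarrow> 'a set list" where
  "remove_cops X Ps = Ps @ [last Ps - X]"

subsection \<open>The STT algorithm\<close>

text \<open>
  Stacks are lists with the top at the head. An index is a binary string, written left to right,
  with \<^term>\<open>True\<close> for the character 1 and \<^term>\<open>False\<close> for 0.
\<close>

type_synonym index = "bool list"

record 'a stt_state =
  stack_B :: "('a set \<times> index) list"
  stack_C :: "('a set \<times> index) list"
  play :: "'a set list"

fun pop_separators ::
  "index \<Rightarrow> ('a set \<times> index) list \<Rightarrow> 'a set list \<Rightarrow> ('a set \<times> index) list \<times> 'a set list" where
  "pop_separators p [] Ps = ([], Ps)"
| "pop_separators p ((S, w') # cs) Ps =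
     (if p = w' then ((S, w') # cs, Ps) else pop_separators p cs (remove_cops S Ps))"

definition separate ::
  "(nat \<Rightarrow> nat) \<Rightarrow> (('a, 'b) pre_digraph \<Rightarrow> 'a set \<times> 'a set \<times> 'a set)
    \<Rightarrow> ('a, 'b) pre_digraph \<Rightarrow> index \<Rightarrow> nat \<Rightarrow> 'a stt_state \<Rightarrow> 'a stt_state" where
  "separate f \<S> H w n st =
     (if card (verts H) \<le> f n
      then st\<lparr>play := remove_cops (verts H) (place_cops (verts H) (play st))\<rparr>
      else case \<S> H of (A, B, C) \<Rightarrow>
        \<lparr>stack_B = (A, w @ [True]) # (B, w @ [False]) # stack_B st,
         stack_C = (C, w) # stack_C st,
         play = place_cops C (play st)\<rparr>)"

text \<open>One iteration of the outer while loop; a terminated run stays put.\<close>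

definition stt_step ::
  "(nat \<Rightarrow> nat) \<Rightarrow> (('a, 'b) pre_digraph \<Rightarrow> 'a set \<times> 'a set \<times> 'a set)
    \<Rightarrow> ('a, 'b) pre_digraph \<Rightarrow> 'a stt_state \<Rightarrow> 'a stt_state" where
  "stt_step f \<S> G st =
     (case stack_B st of
        [] \<Rightarrow> st
      | (U, w) # bs \<Rightarrow>
          (case pop_separators (butlast w) (stack_C st) (play st) of (cs, Ps) \<Rightarrow>
             separate f \<S> (G \<restriction> U) w (card (verts G)) \<lparr>stack_B = bs, stack_C = cs, play = Ps\<rparr>))"

definition stt_init :: "('a, 'b) pre_digraph \<Rightarrow> 'a stt_state" where
  "stt_init G = \<lparr>stack_B = [(verts G, [])], stack_C = [], play = [{}]\<rparr>"

definition stt_run ::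
  "(nat \<Rightarrow> nat) \<Rightarrow> (('a, 'b) pre_digraph \<Rightarrow> 'a set \<times> 'a set \<times> 'a set)
    \<Rightarrow> ('a, 'b) pre_digraph \<Rightarrow> nat \<Rightarrow> 'a stt_state" where
  "stt_run f \<S> G k = (stt_step f \<S> G ^^ k) (stt_init G)"

definition stt_territory ::
  "(nat \<Rightarrow> nat) \<Rightarrow> (('a, 'b) pre_digraph \<Rightarrow> 'a set \<times> 'a set \<times> 'a set)
    \<Rightarrow> ('a, 'b) pre_digraph \<Rightarrow> nat \<Rightarrow> 'a set" where
  "stt_territory f \<S> G k = territory G (play (stt_run f \<S> G k))"

text \<open>
  \<^term>\<open>separates\<close> admits empty sets \<open>A\<close>, \<open>B\<close>, \<open>S\<close>. If a separator is empty, or a popped vertex set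
  is empty, the corresponding iteration places no cop and leaves the territory unchanged. The next
  two definitions single this out: the first asks that whenever the algorithm may be invoked on an
  induced subgraph of \<open>G\<close> (more than \<open>f n\<close> vertices) its output is a partition into nonempty parts;
  the second gives the vertices on which the \<open>(k + 1)\<close>-st iteration places cops.
\<close>

definition nonempty_parts ::
  "(nat \<Rightarrow> nat) \<Rightarrow> (('a, 'b) pre_digraph \<Rightarrow> 'a set \<times> 'a set \<times> 'a set)
    \<Rightarrow> ('a, 'b) pre_digraph \<Rightarrow> bool" where
  "nonempty_parts f \<S> G \<longleftrightarrow>
     (\<forall>U\<subseteq>verts G. f (card (verts G)) < card U \<longrightarrow>
        (case \<S> (G \<restriction> U) of (A, B, C) \<Rightarrow> A \<noteq> {} \<and> B \<noteq> {} \<and> C \<noteq> {}))"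

definition stt_placed ::
  "(nat \<Rightarrow> nat) \<Rightarrow> (('a, 'b) pre_digraph \<Rightarrow> 'a set \<times> 'a set \<times> 'a set)
    \<Rightarrow> ('a, 'b) pre_digraph \<Rightarrow> nat \<Rightarrow> 'a set" where
  "stt_placed f \<S> G k =
     (case stack_B (stt_run f \<S> G k) of
        [] \<Rightarrow> {}
      | (U, w) # bs \<Rightarrow>
          (if card U \<le> f (card (verts G)) then U
           else case \<S> (G \<restriction> U) of (A, B, C) \<Rightarrow> C))"

end

theory Submission
  imports Defs
begin

text \<open>
  The search is a depth-first traversal of the decomposition tree. At the start of every iteration
  the territory is the union of the sets on Stack-B and the cops stand exactly on the separators on
  Stack-C. The neighbours of a set with index \<open>w\<close> on Stack-B lie in that set or in the separators
  of proper prefixes of \<open>w\<close>. Therefore removing the separators of finished subtrees lets nobody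
  escape, and each iteration deletes from the territory precisely the vertices on which it places
  cops.
\<close>

subsection \<open>Evolution of the territory\<close>

text \<open>Reduces a play to its last round, so that later arguments append one cop set at a time.
  With \<open>Ps = []\<close> there would be no previous vertex for \<open>last rs\<close> to
  denote.\<close>

lemma evades_snoc:
  assumes "Ps \<noteq> []"
  shows "evades G (Ps @ [X]) rs' \<longleftrightarrow>
    (\<exists>rs v. rs' = rs @ [v] \<and> evades G Ps rs \<and> v \<in> verts G \<and> v \<notin> X \<and> last rs \<notin> X \<and>
      (v = last rs \<or> last rs \<rightarrow>\<^bsub>G\<^esub> v))" (is "?L \<longleftrightarrow> ?R")
proof
  assume L: ?L
  then have len: "length rs' = Suc (length Ps)"
    by (simp add: evades_def)
  then obtain rs v where rs': "rs' = rs @ [v]"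
    by (metis length_Suc_conv_rev)
  with len have lrs: "length rs = length Ps"
    by simp
  \<comment> \<open>The round condition at index \<open>length Ps - 1\<close> is the one that
    describes the appended move.\<close>
  have l: "last rs = rs ! (length Ps - 1)"
    using lrs assms by (metis last_conv_nth length_0_conv)
  have A: "\<forall>i < Suc (length Ps). (rs @ [v]) ! i \<notin> (Ps @ [X]) ! i"
    and B: "\<forall>i. Suc i < Suc (length Ps) \<longrightarrow> (rs @ [v]) ! i \<notin> (Ps @ [X]) ! Suc i \<and>
      ((rs @ [v]) ! Suc i = (rs @ [v]) ! i \<or> (rs @ [v]) ! i \<rightarrow>\<^bsub>G\<^esub> (rs @ [v]) ! Suc i)"
    and V: "set (rs @ [v]) \<subseteq> verts G"
    using L by (simp_all add: evades_def rs')
  have "rs ! i \<notin> Ps ! i" if "i < length Ps" for i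
    using A[rule_format, of i] that lrs by (simp add: nth_append)
  moreover have "rs ! i \<notin> Ps ! Suc i \<and> (rs ! Suc i = rs ! i \<or> rs ! i \<rightarrow>\<^bsub>G\<^esub> rs ! Suc i)"
    if "Suc i < length Ps" for i
    using B[rule_format, of i] that lrs by (simp add: nth_append)
  ultimately have "evades G Ps rs"
    using V lrs by (simp add: evades_def)
  moreover have "v \<notin> X"
    using A[rule_format, of "length Ps"] lrs by (simp add: nth_append)
  moreover have "last rs \<notin> X \<and> (v = last rs \<or> last rs \<rightarrow>\<^bsub>G\<^esub> v)"
    using B[rule_format, of "length Ps - 1"] lrs assms by (simp add: nth_append l)
  ultimately show ?R
    using V rs' by auto
next
  assume ?R
  then obtain rs v where R: "rs' = rs @ [v]" "evades G Ps rs" "v \<in> verts G" "v \<notin> X"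
    "last rs \<notin> X" "v = last rs \<or> last rs \<rightarrow>\<^bsub>G\<^esub> v"
    by blast
  have lrs: "length rs = length Ps"
    using R(2) by (simp add: evades_def)
  have l: "last rs = rs ! (length Ps - 1)"
    using lrs assms by (metis last_conv_nth length_0_conv)
  have 1: "rs' ! i \<notin> (Ps @ [X]) ! Suc i \<and> (rs' ! Suc i = rs' ! i \<or> rs' ! i \<rightarrow>\<^bsub>G\<^esub> rs' ! Suc i)"
    if "Suc i < length (Ps @ [X])" for i
  proof (cases "Suc i < length Ps")
    case True
    then show ?thesis
      using R(1,2) lrs by (simp add: nth_append evades_def)
  next
    case False
    then have "i = length Ps - 1" "Suc i = length Ps"
      using that by auto
    then show ?thesis
      using R(1,5,6) lrs l by (auto simp: nth_append)
  qed
  moreover have "rs' ! i \<notin> (Ps @ [X]) ! i" if "i < length (Ps @ [X])" for i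
  proof (cases "i < length Ps")
    case True
    then show ?thesis
      using R(1,2) lrs by (simp add: nth_append evades_def)
  next
    case False
    then have "i = length Ps"
      using that by simp
    then show ?thesis
      using R(1,4) lrs by (simp add: nth_append)
  qed
  moreover have "length rs' = length (Ps @ [X])" "set rs' \<subseteq> verts G"
    using R(1-3) lrs by (simp_all add: evades_def)
  ultimately show ?L
    using 1 unfolding evades_def by blast
qed

text \<open>The robber's past matters only through his current vertex, so the territory obeys a
  recursion on sets. \<open>X\<close> is removed twice because he must avoid it before and after
  moving.\<close>

lemma territory_snoc:
  assumes "Ps \<noteq> []"
  shows "territory G (Ps @ [X]) =
    {v \<in> verts G - X. \<exists>u \<in> territory G Ps - X. v = u \<or> u \<rightarrow>\<^bsub>G\<^esub> v}"
proof (intro equalityI subsetI)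
  fix v assume "v \<in> territory G (Ps @ [X])"
  then show "v \<in> {v \<in> verts G - X. \<exists>u \<in> territory G Ps - X. v = u \<or> u \<rightarrow>\<^bsub>G\<^esub> v}"
    unfolding territory_def evades_snoc[OF assms] by force
next
  fix v assume "v \<in> {v \<in> verts G - X. \<exists>u \<in> territory G Ps - X. v = u \<or> u \<rightarrow>\<^bsub>G\<^esub> v}"
  then obtain rs where "evades G Ps rs" "v \<in> verts G" "v \<notin> X" "last rs \<notin> X"
    "v = last rs \<or> last rs \<rightarrow>\<^bsub>G\<^esub> v"
    unfolding territory_def by blast
  then have "evades G (Ps @ [X]) (rs @ [v])"
    unfolding evades_snoc[OF assms] by blast
  then show "v \<in> territory G (Ps @ [X])"
    unfolding territory_def by (metis (mono_tags, lifting) last_snoc mem_Collect_eq)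
qed

lemma territory_subset_verts:
  assumes "Ps \<noteq> []"
  shows "territory G Ps \<subseteq> verts G"
proof
  fix v assume "v \<in> territory G Ps"
  then obtain rs where rs: "evades G Ps rs" "v = last rs"
    unfolding territory_def by blast
  then have "rs \<noteq> []"
    using assms by (auto simp: evades_def)
  then show "v \<in> verts G"
    using rs last_in_set[of rs] by (auto simp: evades_def)
qed

lemma territory_init: "territory G [{}] = verts G"
proof
  show "territory G [{}] \<subseteq> verts G"
    by (rule territory_subset_verts) simp
  have "evades G [{}] [v]" if "v \<in> verts G" for v
    using that by (simp add: evades_def)
  then show "verts G \<subseteq> territory G [{}]"
    unfolding territory_def by force
qed

definition guarded_by :: "('a, 'b) pre_digraph \<Rightarrow> 'a set \<Rightarrow> 'a set \<Rightarrow> bool" where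
  "guarded_by G T X \<longleftrightarrow> (\<forall>u\<in>T. \<forall>v. u \<rightarrow>\<^bsub>G\<^esub> v \<longrightarrow> v \<in> T \<union> X)"

lemma guarded_by_mono: "guarded_by G T X \<Longrightarrow> X \<subseteq> Y \<Longrightarrow> guarded_by G T Y"
  unfolding guarded_by_def by blast

text \<open>The robber may stay put, so \<open>territory G Ps - X\<close> survives, and any move out
  of the territory ends in \<open>X\<close>. This serves placing and removing cops alike, with
  \<open>X\<close> the whole new cop set.\<close>

lemma territory_snoc_guarded:
  assumes "Ps \<noteq> []" "guarded_by G (territory G Ps) X"
  shows "territory G (Ps @ [X]) = territory G Ps - X"
  using assms(2) territory_subset_verts[OF assms(1), of G]
  unfolding territory_snoc[OF assms(1)] guarded_by_def by blast

subsection \<open>The stacks\<close>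

text \<open>Strict, so the length of an index determines its entry on Stack-C. Stack-B, where
  siblings share a length, gets a weak order in the invariant.\<close>

definition labels_decreasing :: "('a set \<times> index) list \<Rightarrow> bool" where
  "labels_decreasing = sorted_wrt (\<lambda>x y. length (snd y) < length (snd x))"

text \<open>Disjointness is between list positions; looking at each pair once suffices because the
  relation is symmetric.\<close>

definition disjoint_entries :: "('a set \<times> index) list \<Rightarrow> bool" where
  "disjoint_entries = sorted_wrt (\<lambda>x y. fst x \<inter> fst y = {})"

definition occupied :: "('a set \<times> index) list \<Rightarrow> 'a set" where
  "occupied xs = \<Union> (fst ` set xs)"

lemma occupied_simps [simp]:
  "occupied [] = {}" "occupied (x # xs) = fst x \<union> occupied xs"
  "occupied (xs @ ys) = occupied xs \<union> occupied ys"
  by (simp_all add: occupied_def image_Un)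

lemma guarded_by_occupied:
  assumes "\<And>U w. (U, w) \<in> set xs \<Longrightarrow> guarded_by G U X"
  shows "guarded_by G (occupied xs) X"
  unfolding guarded_by_def
proof (intro ballI allI impI)
  fix u v assume "u \<in> occupied xs" "u \<rightarrow>\<^bsub>G\<^esub> v"
  then obtain U w where Uw: "(U, w) \<in> set xs" "u \<in> U"
    by (auto simp: occupied_def)
  then have "v \<in> U \<union> X"
    using assms[OF Uw(1)] \<open>u \<rightarrow>\<^bsub>G\<^esub> v\<close> unfolding guarded_by_def by blast
  then show "v \<in> occupied xs \<union> X"
    using Uw(1) by (force simp: occupied_def)
qed

lemma disjoint_entries_simps [simp]:
  "disjoint_entries []"
  "disjoint_entries (x # xs) \<longleftrightarrow> fst x \<inter> occupied xs = {} \<and> disjoint_entries xs"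
  "disjoint_entries (xs @ ys) \<longleftrightarrow>
     disjoint_entries xs \<and> disjoint_entries ys \<and> occupied xs \<inter> occupied ys = {}"
  by (auto simp: disjoint_entries_def occupied_def sorted_wrt_append)

text \<open>The indices on Stack-C always form a chain of prefixes, so comparing lengths suffices to
  single out the proper prefixes of an index of length \<open>l\<close>.\<close>

definition ancestors :: "nat \<Rightarrow> ('a set \<times> index) list \<Rightarrow> ('a set \<times> index) list" where
  "ancestors l = filter (\<lambda>c. length (snd c) < l)"

lemma occupied_ancestors_subset: "occupied (ancestors l cs) \<subseteq> occupied cs"
  by (auto simp: occupied_def ancestors_def)

lemma ancestors_mono: "l \<le> m \<Longrightarrow> occupied (ancestors l cs) \<subseteq> occupied (ancestors m cs)"
  by (fastforce simp: occupied_def ancestors_def)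

lemma ancestors_ancestors: "l \<le> m \<Longrightarrow> ancestors l (ancestors m cs) = ancestors l cs"
  by (induction cs) (auto simp: ancestors_def)

lemma disjoint_entries_ancestors:
  "disjoint_entries cs \<Longrightarrow> disjoint_entries (ancestors l cs)"
  by (simp add: disjoint_entries_def ancestors_def sorted_wrt_filter)

lemma labels_decreasing_ancestors:
  "labels_decreasing cs \<Longrightarrow> labels_decreasing (ancestors l cs)"
  by (simp add: labels_decreasing_def ancestors_def sorted_wrt_filter)

text \<open>Popping stops at the entry labelled \<open>p\<close>, and strictly decreasing lengths
  leave exactly the labels no longer than \<open>p\<close>. The surviving separators alone guard the
  territory, so no intermediate removal recontaminates anything.\<close>

lemma pop_separators_ancestors:
  assumes "labels_decreasing cs" "disjoint_entries cs"
    and "cs = [] \<or> p \<in> snd ` set cs"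
    and "Ps \<noteq> []" "last Ps = occupied cs" "territory G Ps \<inter> occupied cs = {}"
    and "guarded_by G (territory G Ps) (occupied (ancestors (Suc (length p)) cs))"
    and "pop_separators p cs Ps = (cs', Ps')"
  shows "cs' = ancestors (Suc (length p)) cs \<and> Ps' \<noteq> [] \<and> last Ps' = occupied cs' \<and>
    territory G Ps' = territory G Ps"
  using assms
proof (induction cs arbitrary: Ps)
  case Nil
  then show ?case by (auto simp: ancestors_def)
next
  case (Cons c cs)
  obtain S w' where c: "c = (S, w')"
    by fastforce
  show ?case
  proof (cases "p = w'")
    case True
    have "\<forall>x\<in>set cs. length (snd x) < Suc (length p)"
      using Cons.prems(1) True c by (auto simp: labels_decreasing_def)
    then have "ancestors (Suc (length p)) (c # cs) = c # cs"
      using True c by (simp add: ancestors_def)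
    moreover have "cs' = c # cs" "Ps' = Ps"
      using Cons.prems(8) True c by auto
    ultimately show ?thesis
      using Cons.prems(4,5) by simp
  next
    case False
    then have p: "p \<in> snd ` set cs"
      using Cons.prems(3) c by auto
    \<comment> \<open>The entry labelled \<open>p\<close> lies below the top, so the top is not an
      ancestor and the required guard does not involve \<open>S\<close>.\<close>
    then have "length p < length w'"
      using Cons.prems(1) c by (auto simp: labels_decreasing_def)
    then have anc: "ancestors (Suc (length p)) (c # cs) = ancestors (Suc (length p)) cs"
      using c by (simp add: ancestors_def)
    let ?Qs = "remove_cops S Ps"
    \<comment> \<open>Separators are disjoint, so taking away \<open>S\<close> frees no vertex of
      the remaining ones.\<close>
    have Qs: "?Qs = Ps @ [occupied cs]"
      using Cons.prems(2,5) c by (auto simp: remove_cops_def)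
    have "guarded_by G (territory G Ps) (occupied cs)"
      using Cons.prems(7) anc occupied_ancestors_subset guarded_by_mono by metis
    then have T: "territory G ?Qs = territory G Ps"
      using territory_snoc_guarded[OF Cons.prems(4)] Cons.prems(6) Qs by auto
    have "cs' = ancestors (Suc (length p)) cs \<and> Ps' \<noteq> [] \<and> last Ps' = occupied cs' \<and>
      territory G Ps' = territory G ?Qs"
    proof (rule Cons.IH)
      show "labels_decreasing cs"
        using Cons.prems(1) by (simp add: labels_decreasing_def)
      show "pop_separators p cs ?Qs = (cs', Ps')"
        using Cons.prems(8) c False by simp
      show "disjoint_entries cs"
        using Cons.prems(2) by simp
      show "cs = [] \<or> p \<in> snd ` set cs"
        using p by blast
      show "?Qs \<noteq> []" "last ?Qs = occupied cs"
        using Qs by simp_all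
      show "territory G ?Qs \<inter> occupied cs = {}"
        using Cons.prems(6) T by auto
      show "guarded_by G (territory G ?Qs) (occupied (ancestors (Suc (length p)) cs))"
        using Cons.prems(7) T anc by simp
    qed
    then show ?thesis
      using T anc by simp
  qed
qed

subsection \<open>The search invariant\<close>

text \<open>The root has no parent (\<open>butlast [] = []\<close>), so its clause instead says that
  it is alone. The guard uses only separators of proper prefixes, which are still on Stack-C when
  the entry gets popped.\<close>

definition stack_entry ::
  "('a, 'b) pre_digraph \<Rightarrow> 'a stt_state \<Rightarrow> 'a set \<Rightarrow> index \<Rightarrow> bool" where
  "stack_entry G st U w \<longleftrightarrow>
     U \<subseteq> verts G \<and>
     (if w = [] then stack_B st = [(U, [])] \<and> stack_C st = []
      else butlast w \<in> snd ` set (stack_C st)) \<and>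
     guarded_by G U (occupied (ancestors (length w) (stack_C st)))"

text \<open>The order on Stack-B makes the top index a longest one, so popping for it keeps the
  guards of all entries. Joint disjointness of the stacks keeps cops off the territory.\<close>

definition stt_invariant :: "('a, 'b) pre_digraph \<Rightarrow> 'a stt_state \<Rightarrow> bool" where
  "stt_invariant G st \<longleftrightarrow>
     (\<forall>(U, w) \<in> set (stack_B st). stack_entry G st U w) \<and>
     sorted_wrt (\<lambda>x y. length (snd y) \<le> length (snd x)) (stack_B st) \<and>
     labels_decreasing (stack_C st) \<and>
     disjoint_entries (stack_B st @ stack_C st) \<and>
     play st \<noteq> [] \<and>
     last (play st) = occupied (stack_C st) \<and>
     territory G (play st) = occupied (stack_B st)"

definition placed ::
  "(nat \<Rightarrow> nat) \<Rightarrow> (('a, 'b) pre_digraph \<Rightarrow> 'a set \<times> 'a set \<times> 'a set)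
    \<Rightarrow> ('a, 'b) pre_digraph \<Rightarrow> 'a set \<Rightarrow> 'a set" where
  "placed f \<S> G U =
     (if card U \<le> f (card (verts G)) then U else case \<S> (G \<restriction> U) of (A, B, C) \<Rightarrow> C)"

text \<open>Every call of Separate is on an induced subgraph of \<open>G\<close>; the guarantee of
  the separation algorithm is stated for these.\<close>

locale stt_search = fin_digraph G for G :: "('a, 'b) pre_digraph" +
  fixes f :: "nat \<Rightarrow> nat"
    and \<S> :: "('a, 'b) pre_digraph \<Rightarrow> 'a set \<times> 'a set \<times> 'a set"
  assumes separates: "U \<subseteq> verts G \<Longrightarrow> \<S> (G \<restriction> U) = (A, B, C) \<Longrightarrow>
    separates (G \<restriction> U) (f (card U)) (2/3) A B C"
begin

section \<open>Separators of induced subgraphs\<close>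

lemma separation_partition:
  assumes "U \<subseteq> verts G" "\<S> (G \<restriction> U) = (A, B, C)"
  shows "U = A \<union> B \<union> C" "A \<inter> B = {}" "A \<inter> C = {}" "B \<inter> C = {}"
  using separates[OF assms] by (simp_all add: separates_def)

text \<open>An arc leaving \<open>A\<close> either leaves \<open>U\<close>, hence ends in
  \<open>X\<close>, or stays in \<open>U\<close>, where it cannot reach \<open>B\<close>.\<close>

lemma separation_guarded:
  assumes "U \<subseteq> verts G" "\<S> (G \<restriction> U) = (A, B, C)" "guarded_by G U X"
  shows "guarded_by G A (C \<union> X)" "guarded_by G B (C \<union> X)"
proof -
  \<comment> \<open>The separator forbids arcs of the induced subgraph only, so arcs of
    \<open>G\<close> inside \<open>U\<close> are transferred to it.\<close>
  have "a \<rightarrow>\<^bsub>G \<restriction> U\<^esub> b" if "a \<rightarrow>\<^bsub>G\<^esub> b" "a \<in> U" "b \<in> U" for a b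
    using that by (auto simp: arcs_ends_def arc_to_ends_def)
  moreover have "\<forall>a\<in>A. \<forall>b\<in>B. \<not> a \<rightarrow>\<^bsub>G \<restriction> U\<^esub> b \<and> \<not> b \<rightarrow>\<^bsub>G \<restriction> U\<^esub> a"
    using separates[OF assms(1,2)] unfolding separates_def by blast
  ultimately show "guarded_by G A (C \<union> X)" "guarded_by G B (C \<union> X)"
    using assms(3) separation_partition(1)[OF assms(1,2)] unfolding guarded_by_def by blast+
qed

text \<open>Strict because 2/3 < 1 and \<open>card U > 0\<close>; this drives termination.\<close>

lemma separation_smaller:
  assumes "U \<subseteq> verts G" "\<S> (G \<restriction> U) = (A, B, C)" "U \<noteq> {}"
  shows "card A < card U" "card B < card U"
proof -
  have "card U > 0"
    using assms(1,3) finite_subset[OF _ finite_verts] by (auto simp: card_gt_0_iff)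
  then show "card A < card U" "card B < card U"
    using separates[OF assms(1,2)] by (auto simp: separates_def)
qed

section \<open>Preservation of the invariant during an iteration\<close>

lemma invariant_init: "stt_invariant G (stt_init G)"
  by (auto simp: stt_invariant_def stt_init_def stack_entry_def territory_init
      guarded_by_def labels_decreasing_def adj_in_verts)

text \<open>No index on Stack-B is longer than \<open>w\<close>, so every guard consists of
  separators that survive. \<open>U\<close> is kept on Stack-B here because it is still part of the
  territory.\<close>

lemma invariant_pop:
  assumes "stt_invariant G st" "stack_B st = (U, w) # bs"
    and "pop_separators (butlast w) (stack_C st) (play st) = (cs, Ps)"
  shows "stt_invariant G (st\<lparr>stack_C := cs, play := Ps\<rparr>)"
    and "occupied (ancestors (length w) cs) = occupied cs"
    and "\<And>c. c \<in> set cs \<Longrightarrow> length (snd c) < length w"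
    and "territory G Ps = territory G (play st)"
proof -
  note inv = assms(1)[unfolded stt_invariant_def]
  have e: "stack_entry G st U w"
    using inv assms(2) by simp
  have l: "length v \<le> length w" if "(V, v) \<in> set (stack_B st)" for V v
    using inv assms(2) that by auto
  have guarded: "guarded_by G V (occupied (ancestors (length w) (stack_C st)))"
    if "(V, v) \<in> set (stack_B st)" for V v
    using inv that ancestors_mono[OF l[OF that], of "stack_C st"]
    by (force simp: stack_entry_def intro: guarded_by_mono)
  have TG: "guarded_by G (territory G (play st)) (occupied (ancestors (length w) (stack_C st)))"
    using inv guarded guarded_by_occupied by metis
  have w: "w = [] \<Longrightarrow> stack_C st = []"
    using e by (simp add: stack_entry_def)
  \<comment> \<open>For \<open>w = []\<close> the lengths are 1 and 0, but then Stack-C is empty and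
    both sides agree.\<close>
  have len: "ancestors (Suc (length (butlast w))) (stack_C st) = ancestors (length w) (stack_C st)"
    by (cases "w = []") (auto simp: w ancestors_def)
  have pop: "cs = ancestors (Suc (length (butlast w))) (stack_C st) \<and> Ps \<noteq> [] \<and>
      last Ps = occupied cs \<and> territory G Ps = territory G (play st)"
  proof (rule pop_separators_ancestors)
    show "stack_C st = [] \<or> butlast w \<in> snd ` set (stack_C st)"
      using e by (auto simp: stack_entry_def split: if_splits)
    show "guarded_by G (territory G (play st))
        (occupied (ancestors (Suc (length (butlast w))) (stack_C st)))"
      using TG len by simp
  qed (use inv assms(3) in auto)
  then show "territory G Ps = territory G (play st)"
    by simp
  from pop have cs: "cs = ancestors (length w) (stack_C st)"
    using len by simp
  then show "occupied (ancestors (length w) cs) = occupied cs"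
    by (simp add: ancestors_ancestors)
  show "\<And>c. c \<in> set cs \<Longrightarrow> length (snd c) < length w"
    using cs by (simp add: ancestors_def)
  have "stack_entry G (st\<lparr>stack_C := cs, play := Ps\<rparr>) V v" if V: "(V, v) \<in> set (stack_B st)" for V v
  proof -
    have e': "stack_entry G st V v"
      using inv V by auto
    \<comment> \<open>The parent index is strictly shorter than \<open>v\<close>, hence than
      \<open>w\<close>, so its separator is not popped.\<close>
    have anc: "butlast v \<in> snd ` set cs" if "v \<noteq> []"
    proof -
      have "butlast v \<in> snd ` set (stack_C st)"
        using e' that by (simp add: stack_entry_def)
      moreover have "length (butlast v) < length w"
        using l[OF V] that by (cases v) auto
      ultimately show ?thesis
        by (force simp: cs ancestors_def)
    qed
    have "v = [] \<Longrightarrow> cs = []"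
      using e' by (simp add: stack_entry_def cs ancestors_def)
    then show ?thesis
      using e' anc ancestors_ancestors[OF l[OF V], of "stack_C st"] cs
      by (auto simp: stack_entry_def)
  qed
  moreover have "occupied cs \<subseteq> occupied (stack_C st)"
    unfolding cs by (rule occupied_ancestors_subset)
  ultimately show "stt_invariant G (st\<lparr>stack_C := cs, play := Ps\<rparr>)"
    using inv pop cs
    by (auto simp: stt_invariant_def disjoint_entries_ancestors labels_decreasing_ancestors)
qed

text \<open>The root entry is alone on Stack-B. Hence the root clause of \<open>stack_entry\<close>,
  which mentions both whole stacks, never concerns the entries that outlive an iteration.\<close>

lemma invariant_rest_nonempty_label:
  assumes "stt_invariant G st" "stack_B st = (U, w) # bs" "(V, v) \<in> set bs"
  shows "v \<noteq> []"
proof -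
  have "stack_entry G st V v"
    using assms by (auto simp: stt_invariant_def)
  then show ?thesis
    using assms(2,3) by (auto simp: stack_entry_def split: if_splits)
qed

text \<open>Placing cops on \<open>U\<close> empties it of the robber; the rest of the territory is
  guarded by Stack-C without \<open>U\<close>, so lifting these cops lets nobody back in.\<close>

lemma invariant_clear:
  assumes inv: "stt_invariant G \<lparr>stack_B = (U, w) # bs, stack_C = cs, play = Ps\<rparr>"
    (is "stt_invariant G ?st")
  defines "Qs \<equiv> remove_cops U (place_cops U Ps)"
  shows "stt_invariant G \<lparr>stack_B = bs, stack_C = cs, play = Qs\<rparr>"
    and "territory G Qs = territory G Ps - U"
proof -
  note inv' = inv[unfolded stt_invariant_def, simplified]
  let ?Ps = "Ps @ [occupied cs \<union> U]"
  have entry: "stack_entry G \<lparr>stack_B = bs, stack_C = cs, play = Qs\<rparr> V v"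
    if V: "(V, v) \<in> set bs" for V v
  proof -
    have "stack_entry G ?st V v"
      using inv' V by auto
    then show ?thesis
      using invariant_rest_nonempty_label[OF inv _ V] by (simp add: stack_entry_def)
  qed
  have guarded: "guarded_by G V (occupied cs)" if "(V, v) \<in> set ((U, w) # bs)" for V v
    using inv' that occupied_ancestors_subset[of "length v" cs]
    by (force simp: stack_entry_def intro: guarded_by_mono)
  have "guarded_by G (occupied ((U, w) # bs)) (occupied cs)"
    using guarded by (rule guarded_by_occupied)
  then have TU: "guarded_by G (U \<union> occupied bs) (occupied cs)"
    by simp
  have "guarded_by G V (occupied cs)" if "(V, v) \<in> set bs" for V v
    using guarded[of V v] that by simp
  then have TB: "guarded_by G (occupied bs) (occupied cs)"
    by (rule guarded_by_occupied)
  have "territory G ?Ps = territory G Ps - (occupied cs \<union> U)"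
    using inv' guarded_by_mono[OF TU, of "occupied cs \<union> U"]
    by (intro territory_snoc_guarded) auto
  also have "\<dots> = occupied bs"
    using inv' by auto
  finally have T: "territory G ?Ps = occupied bs" .
  \<comment> \<open>\<open>U\<close> is disjoint from the separators, so the removal restores the
    earlier cop set exactly.\<close>
  have Qs: "Qs = ?Ps @ [occupied cs]"
    using inv' by (auto simp: Qs_def place_cops_def remove_cops_def)
  have "territory G Qs = territory G ?Ps - occupied cs"
    unfolding Qs using TB T by (intro territory_snoc_guarded) auto
  then have TQ: "territory G Qs = occupied bs"
    using T inv' by auto
  then show "territory G Qs = territory G Ps - U"
    using inv' by auto
  show "stt_invariant G \<lparr>stack_B = bs, stack_C = cs, play = Qs\<rparr>"
    using inv' entry TQ Qs by (auto simp: stt_invariant_def)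
qed

text \<open>After the pop all labels on Stack-C are shorter than \<open>w\<close>, so
  \<open>w\<close> extends the chain and both children have the whole new Stack-C as
  ancestors.\<close>

lemma invariant_split:
  assumes inv: "stt_invariant G \<lparr>stack_B = (U, w) # bs, stack_C = cs, play = Ps\<rparr>"
    (is "stt_invariant G ?st")
    and all_anc: "\<And>c. c \<in> set cs \<Longrightarrow> length (snd c) < length w"
    and sep: "\<S> (G \<restriction> U) = (A, B, C)"
  shows "stt_invariant G \<lparr>stack_B = (A, w @ [True]) # (B, w @ [False]) # bs,
      stack_C = (C, w) # cs, play = place_cops C Ps\<rparr>" (is "stt_invariant G ?st'")
    and "territory G (place_cops C Ps) = territory G Ps - C"
proof -
  note inv' = inv[unfolded stt_invariant_def, simplified]
  have U: "U \<subseteq> verts G" and GU: "guarded_by G U (occupied cs)"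
    using inv' occupied_ancestors_subset[of "length w" cs]
    by (auto simp: stack_entry_def intro: guarded_by_mono)
  note part = separation_partition[OF U sep]
  have w: "length v \<le> length w" if "(V, v) \<in> set bs" for V v
    using inv' that by auto
  have anc: "ancestors (Suc (length w)) ((C, w) # cs) = (C, w) # cs"
    using all_anc by (fastforce simp: ancestors_def intro: filter_True)
  have A: "stack_entry G ?st' A (w @ [True])" and B: "stack_entry G ?st' B (w @ [False])"
    using U part(1) separation_guarded[OF U sep GU] by (auto simp: stack_entry_def anc)
  have entry: "stack_entry G ?st' V v" if V: "(V, v) \<in> set bs" for V v
  proof -
    have "stack_entry G ?st V v"
      using inv' V by auto
    \<comment> \<open>\<open>w\<close> is not shorter than \<open>v\<close>, so \<open>C\<close>
      does not enter the guard of an older entry.\<close>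
    moreover have "ancestors (length v) ((C, w) # cs) = ancestors (length v) cs"
      using w[OF V] by (simp add: ancestors_def)
    ultimately show ?thesis
      using invariant_rest_nonempty_label[OF inv, of U w bs V v] V
      by (auto simp: stack_entry_def)
  qed
  have "guarded_by G V (occupied cs)" if "(V, v) \<in> set bs" for V v
    using inv' that occupied_ancestors_subset[of "length v" cs]
    by (force simp: stack_entry_def intro: guarded_by_mono)
  with GU have "guarded_by G (occupied ((U, w) # bs)) (occupied cs)"
    by (intro guarded_by_occupied) auto
  then have "guarded_by G (occupied ((U, w) # bs)) (occupied cs \<union> C)"
    by (rule guarded_by_mono) simp
  then have "guarded_by G (territory G Ps) (occupied cs \<union> C)"
    using inv' by simp
  then have "territory G (place_cops C Ps) = territory G Ps - (occupied cs \<union> C)"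
    using inv' territory_snoc_guarded[of Ps G "occupied cs \<union> C"] by (simp add: place_cops_def)
  then show T: "territory G (place_cops C Ps) = territory G Ps - C"
    using inv' by auto
  have "territory G (place_cops C Ps) = A \<union> B \<union> occupied bs"
    using inv' part by (auto simp: T)
  moreover have "sorted_wrt (\<lambda>x y. length (snd y) \<le> length (snd x)) (stack_B ?st')"
    using inv' w by fastforce
  moreover have "labels_decreasing (stack_C ?st')"
    using inv' all_anc by (auto simp: labels_decreasing_def)
  moreover have "disjoint_entries (stack_B ?st' @ stack_C ?st')"
    using inv' part by auto
  moreover have "last (play ?st') = occupied (stack_C ?st')" "play ?st' \<noteq> []"
    using inv' by (auto simp: place_cops_def)
  ultimately show "stt_invariant G ?st'"
    unfolding stt_invariant_def using A B entry by auto
qed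

lemma step_cases:
  assumes "stt_invariant G st" "stack_B st = (U, w) # bs"
  obtains (clear) "card U \<le> f (card (verts G))" "stack_B (stt_step f \<S> G st) = bs"
    | (split) A B C where "f (card (verts G)) < card U" "\<S> (G \<restriction> U) = (A, B, C)"
      "stack_B (stt_step f \<S> G st) = (A, w @ [True]) # (B, w @ [False]) # bs"
proof (cases "card U \<le> f (card (verts G))")
  case True
  then show ?thesis
    using assms by (intro clear) (auto simp: stt_step_def separate_def split: prod.split)
next
  case False
  then show ?thesis
    using assms
    by (cases "\<S> (G \<restriction> U)")
      (intro split, auto simp: stt_step_def separate_def split: prod.split)
qed

lemma invariant_step:
  assumes inv: "stt_invariant G st" and B: "stack_B st = (U, w) # bs"
  shows "stt_invariant G (stt_step f \<S> G st) \<and>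
    territory G (play (stt_step f \<S> G st)) = territory G (play st) - placed f \<S> G U"
proof -
  obtain cs Ps where pop: "pop_separators (butlast w) (stack_C st) (play st) = (cs, Ps)"
    by fastforce
  have st: "st\<lparr>stack_C := cs, play := Ps\<rparr> = \<lparr>stack_B = (U, w) # bs, stack_C = cs, play = Ps\<rparr>"
    using B by simp
  note popped = invariant_pop[OF inv B pop, unfolded st]
  obtain A B' C where sep: "\<S> (G \<restriction> U) = (A, B', C)"
    by (cases "\<S> (G \<restriction> U)")
  show ?thesis
  proof (cases "card U \<le> f (card (verts G))")
    case True
    then show ?thesis
      using invariant_clear[OF popped(1)] popped(4) B pop
      by (simp add: stt_step_def separate_def placed_def)
  next
    case False
    then show ?thesis
      using invariant_split[OF popped(1,3) sep] popped(4) B pop sep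
      by (simp add: stt_step_def separate_def placed_def)
  qed
qed

section \<open>The territory along a run\<close>

lemma invariant_run: "stt_invariant G (stt_run f \<S> G k)"
proof (induction k)
  case 0
  then show ?case by (simp add: stt_run_def invariant_init)
next
  case (Suc k)
  then show ?case
    using invariant_step[of "stt_run f \<S> G k"]
    by (cases "stack_B (stt_run f \<S> G k)") (auto simp: stt_run_def stt_step_def)
qed

lemma territory_run: "stt_territory f \<S> G k = occupied (stack_B (stt_run f \<S> G k))"
  using invariant_run[of k] by (simp add: stt_invariant_def stt_territory_def)

lemma stt_placed_Cons:
  "stack_B (stt_run f \<S> G k) = (U, w) # bs \<Longrightarrow> stt_placed f \<S> G k = placed f \<S> G U"
  by (simp add: stt_placed_def placed_def)

lemma territory_Suc: "stt_territory f \<S> G (Suc k) = stt_territory f \<S> G k - stt_placed f \<S> G k"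
proof (cases "stack_B (stt_run f \<S> G k)")
  case Nil
  then show ?thesis
    by (simp add: stt_territory_def stt_run_def stt_step_def stt_placed_def)
next
  case (Cons x bs)
  obtain U w where "x = (U, w)"
    by fastforce
  then show ?thesis
    using invariant_step[OF invariant_run, of k U w bs] Cons
    by (simp add: stt_territory_def stt_run_def stt_placed_Cons[of k])
qed

lemma entry_run:
  assumes "stack_B (stt_run f \<S> G k) = (U, w) # bs"
  shows "U \<subseteq> verts G" "U \<subseteq> stt_territory f \<S> G k"
  using invariant_run[of k] assms by (auto simp: territory_run stt_invariant_def stack_entry_def)

text \<open>Both \<open>U\<close> and its separator lie in the popped set, which is part of the
  territory. Hence the descent is strict exactly when some cop is placed.\<close>

lemma placed_subset_territory: "stt_placed f \<S> G k \<subseteq> stt_territory f \<S> G k"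
proof (cases "stack_B (stt_run f \<S> G k)")
  case (Cons x bs)
  obtain U w A B C where "x = (U, w)" "\<S> (G \<restriction> U) = (A, B, C)"
    by (metis surj_pair)
  then show ?thesis
    using entry_run[of k U w bs] separation_partition(1)[of U A B C] Cons
    by (auto simp: stt_placed_Cons[of k] placed_def)
qed (simp add: stt_placed_def)

lemma territory_strict_iff:
  "stt_territory f \<S> G (Suc k) \<subset> stt_territory f \<S> G k \<longleftrightarrow> stt_placed f \<S> G k \<noteq> {}"
  using territory_Suc[of k] placed_subset_territory[of k] by blast

section \<open>Strict descent for nonempty parts\<close>

lemma nonempty_partsD:
  assumes "nonempty_parts f \<S> G" "U \<subseteq> verts G" "f (card (verts G)) < card U"
    and "\<S> (G \<restriction> U) = (A, B, C)"
  shows "A \<noteq> {} \<and> B \<noteq> {} \<and> C \<noteq> {}"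
  using assms(1)[unfolded nonempty_parts_def, rule_format, OF assms(2,3)] assms(4) by simp

text \<open>Every entry other than the root arises as a part \<open>A\<close> or \<open>B\<close> of
  some split.\<close>

lemma nonempty_parts_stack_B:
  assumes "nonempty_parts f \<S> G" "(U, w) \<in> set (stack_B (stt_run f \<S> G k))" "w \<noteq> []"
  shows "U \<noteq> {}"
  using assms(2,3)
proof (induction k arbitrary: U w)
  case 0
  then show ?case by (simp add: stt_run_def stt_init_def)
next
  case (Suc k)
  show ?case
  proof (cases "stack_B (stt_run f \<S> G k)")
    case Nil
    then show ?thesis
      using Suc by (auto simp: stt_run_def stt_step_def)
  next
    case (Cons x bs)
    obtain V v where x: "x = (V, v)"
      by fastforce
    have V: "V \<subseteq> verts G"
      using entry_run Cons x by blast
    have run: "stt_run f \<S> G (Suc k) = stt_step f \<S> G (stt_run f \<S> G k)"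
      by (simp add: stt_run_def)
    from invariant_run[of k] Cons[unfolded x] show ?thesis
    proof (cases rule: step_cases)
      case clear
      then show ?thesis
        using Suc Cons run by auto
    next
      case (split A B C)
      then have "A \<noteq> {}" "B \<noteq> {}"
        using nonempty_partsD[OF assms(1) V] by auto
      moreover have "(U, w) \<in> {(A, v @ [True]), (B, v @ [False])} \<union> set bs"
        using Suc.prems(1) run split(3) by simp
      ultimately show ?thesis
        using Suc.IH[of U w] Suc.prems(2) Cons by auto
    qed
  qed
qed

lemma nonempty_parts_placed:
  assumes parts: "nonempty_parts f \<S> G" and T: "stt_territory f \<S> G k \<noteq> {}"
  shows "stt_placed f \<S> G k \<noteq> {}"
proof -
  obtain U w bs where B: "stack_B (stt_run f \<S> G k) = (U, w) # bs"
    using T by (cases "stack_B (stt_run f \<S> G k)") (auto simp: territory_run)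
  have "stack_entry G (stt_run f \<S> G k) U w"
    using invariant_run[of k] B by (simp add: stt_invariant_def)
  \<comment> \<open>At the root the territory is \<open>U\<close> itself, so \<open>U\<close> is
    nonempty by \<open>T\<close>; other entries are covered by the preceding lemma.\<close>
  then have "w = [] \<Longrightarrow> bs = []"
    using B by (simp add: stack_entry_def)
  then have "U \<noteq> {}"
    using nonempty_parts_stack_B[OF parts, of U w k] T B by (cases "w = []") (auto simp: territory_run)
  obtain A B' C where sep: "\<S> (G \<restriction> U) = (A, B', C)"
    by (cases "\<S> (G \<restriction> U)")
  have "C \<noteq> {}" if "f (card (verts G)) < card U"
    using nonempty_partsD[OF parts entry_run(1)[OF B] that sep] by blast
  then show ?thesis
    using \<open>U \<noteq> {}\<close> sep by (simp add: stt_placed_Cons[OF B] placed_def)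
qed

subsection \<open>Termination\<close>

text \<open>Base 3 makes the two parts of a split weigh less than the whole even when one of them is
  empty.\<close>

definition weight :: "'a stt_state \<Rightarrow> nat" where
  "weight st = (\<Sum>(U, w) \<leftarrow> stack_B st. 3 ^ card U)"

lemma weight_step:
  assumes "stt_invariant G st" "stack_B st \<noteq> []"
  shows "weight (stt_step f \<S> G st) < weight st"
proof -
  obtain U w bs where B: "stack_B st = (U, w) # bs"
    using assms(2) by (metis neq_Nil_conv surj_pair)
  have U: "U \<subseteq> verts G"
    using assms(1) B by (auto simp: stt_invariant_def stack_entry_def)
  from assms(1) B show ?thesis
  proof (cases rule: step_cases)
    \<comment> \<open>Even an empty \<open>U\<close> has weight \<open>3 ^ 0 = 1\<close>, so
      dropping it lowers the total.\<close>
    case clear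
    then show ?thesis
      using B by (simp add: weight_def)
  next
    case (split A B' C)
    then obtain m where m: "card U = Suc m"
      by (metis less_zeroE not0_implies_Suc)
    then have "card A \<le> m" "card B' \<le> m"
      using separation_smaller[OF U split(2)] by fastforce+
    then have "(3::nat) ^ card A \<le> 3 ^ m" "(3::nat) ^ card B' \<le> 3 ^ m"
      by (simp_all add: power_increasing)
    moreover have "(0::nat) < 3 ^ m"
      by simp
    \<comment> \<open>The parts weigh at most twice \<open>3 ^ m\<close>, while \<open>U\<close>
      weighs three times as much as \<open>3 ^ m\<close>.\<close>
    ultimately have "(3::nat) ^ card A + 3 ^ card B' < 3 ^ card U"
      unfolding m power_Suc by linarith
    then show ?thesis
      using split(3) B by (simp add: weight_def)
  qed
qed

text \<open>At an iteration of least weight no further decrease is possible, so Stack-B must be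
  empty there.\<close>

lemma terminates: "\<exists>K. stack_B (stt_run f \<S> G K) = []"
proof -
  obtain K where "\<forall>j. weight (stt_run f \<S> G K) \<le> weight (stt_run f \<S> G j)"
    using ex_has_least_nat[of "\<lambda>_. True" 0 "\<lambda>k. weight (stt_run f \<S> G k)"] by auto
  then have "\<not> weight (stt_step f \<S> G (stt_run f \<S> G K)) < weight (stt_run f \<S> G K)"
    by (metis (no_types, lifting) comp_apply funpow.simps(2) linorder_not_less stt_run_def)
  then show ?thesis
    using weight_step[OF invariant_run] by blast
qed

text \<open>The territory is then empty, and any evading trajectory would contribute its last
  vertex.\<close>

lemma caught_if_stack_B_empty:
  assumes "stack_B (stt_run f \<S> G k) = []"
  shows "robber_caught G (play (stt_run f \<S> G k))"
  using territory_run[of k] assms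
  by (auto simp: stt_territory_def territory_def robber_caught_def)

end

text \<open>Since \<open>separates\<close> admits empty parts, an iteration may place no cop. Strict
  descent is therefore claimed under \<open>nonempty_parts\<close>, and in general with such idle
  iterations as the only exception.\<close>

theorem theorem1:
  fixes G :: "('a, 'b) pre_digraph"
    and \<C> :: "('a, 'b) pre_digraph set"
    and f :: "nat \<Rightarrow> nat"
    and \<S> :: "('a, 'b) pre_digraph \<Rightarrow> 'a set \<times> 'a set \<times> 'a set"
  assumes "\<forall>H\<in>\<C>. graph H"
    and "hereditary \<C>"
    and "f_separable f \<C>"
    and "separation_algorithm f \<C> \<S>"
    and "G \<in> \<C>"
  shows "(nonempty_parts f \<S> G \<longrightarrow>
            (\<forall>k. card (stt_territory f \<S> G k) > 0 \<longrightarrow>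
               stt_territory f \<S> G (Suc k) \<subset> stt_territory f \<S> G k)) \<and>
         (\<forall>k. card (stt_territory f \<S> G k) > 0 \<longrightarrow>
            stt_territory f \<S> G (Suc k) \<subset> stt_territory f \<S> G k \<or>
            stt_territory f \<S> G (Suc k) = stt_territory f \<S> G k \<and> stt_placed f \<S> G k = {}) \<and>
         (\<exists>K. stack_B (stt_run f \<S> G K) = [] \<and> robber_caught G (play (stt_run f \<S> G K)))"
proof -
  interpret graph G
    using assms(1,5) by blast
  interpret stt_search G f \<S>
  proof
    fix U A B C
    assume "U \<subseteq> verts G" and sep: "\<S> (G \<restriction> U) = (A, B, C)"
    then have "G \<restriction> U \<in> \<C>"
      using assms(2,5) by (auto simp: hereditary_def)
    then show "separates (G \<restriction> U) (f (card U)) (2/3) A B C"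
      using assms(4) sep by (fastforce simp: separation_algorithm_def)
  qed
  have "stt_territory f \<S> G (Suc k) = stt_territory f \<S> G k" if "stt_placed f \<S> G k = {}" for k
    using territory_Suc[of k] that by simp
  moreover have "stt_placed f \<S> G k \<noteq> {}"
    if "nonempty_parts f \<S> G" "card (stt_territory f \<S> G k) > 0" for k
    using nonempty_parts_placed that by (metis card.empty less_irrefl)
  ultimately show ?thesis
    using terminates caught_if_stack_B_empty unfolding territory_strict_iff by blast
qed

end
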